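(* Let $m,n\ge2$, $0\le r_1\le m-1$, $0\le r_2\le n-1$. The line graph $\Lambda(P_m^{(r_1)}\times P_n^{(r_2)})$ of the Cartesian product of signed paths with $m$ and $n$ vertices has the eigenvalues $$\lambda_{ij}=-2-2\Big(\cos\frac{\pi i}{m}+\cos\frac{\pi j}{n}\Big),\qquad 1\le i\le m,\ 1\le j\le n,$$ of which all are $<2$ except that $\lambda_{mn}=2$, and also $2$ with additional multiplicity $(m-1)(n-1)-1$. The energy is $$E\big(\Lambda(P_m^{(r_1)}\times P_n^{(r_2)})\big)=2\sum_{i=1}^m\sum_{j=1}^n\Big|1+\cos\frac{\pi i}{m}+\cos\frac{\pi j}{n}\Big|+2(m-1)(n-1)-2.$$
   Context: A signed graph $\Sigma=(G,\sigma)$ is a finite simple graph $G=(V,E)$ with a function $\sigma:E\to\{+1,-1\}$. The adjacency matrix $A(\Sigma)$ has $(u,v)$ entry $\sigma(uv)$ if $u,v$ are adjacent and $0$ otherwise; its eigenvalues are the eigenvalues of $\Sigma$, and the energy $E(\Sigma)$ is the sum of their absolute values. The Cartesian product of signed graphs $\Sigma_i=(V_i,E_i,\sigma_i)$, $i=1,2$, is the signed graph on $V_1\times V_2$ in which $(u,v)(u',v')$ is an edge iff $v=v'$ and $uu'\in E_1$ (sign $\sigma_1(uu')$), or $u=u'$ and $vv'\in E_2$ (sign $\sigma_2(vv')$). $P_n^{(r)}$ denotes any signed path with $n$ vertices having exactly $r$ negative edges. Incidence matrix of a signed graph $\Sigma$ with $p$ vertices and $q$ edges: a $p\times q$ matrix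 $H(\Sigma)=[\eta_{ik}]$ with $\eta_{ik}=0$ if vertex $v_i$ is not incident with edge $e_k$, $\eta_{ik}=\pm1$ if it is, and $\eta_{ik}\eta_{jk}=-\sigma(v_iv_j)$ for each edge $e_k=v_iv_j$; unique up to multiplying columns by $-1$. Line graph: $\Lambda(\Sigma)$ is the signed graph whose underlying graph is the ordinary line graph of $G$, with signature given by $A(\Lambda(\Sigma))=2I_q-H(\Sigma)^{\mathrm T}H(\Sigma)$ (so every cycle of $\Sigma$ becomes a cycle of the same sign, and any three edges at a common vertex become a negative triangle); the choice of $H(\Sigma)$ does not affect eigenvalues. *)

theory Defs
  imports
    "HOL-Computational_Algebra.Computational_Algebra"
    "Jordan_Normal_Form.Char_Poly"
begin

text \<open>
  Edges are two-element vertex sets; the value of \<open>esign\<close> outside the edge set is irrelevant.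
\<close>

record 'a sgraph =
  verts :: "'a set"
  edges :: "'a set set"
  esign :: "'a set \<Rightarrow> int"

definition signed_graph :: "'a sgraph \<Rightarrow> bool" where
  "signed_graph S \<longleftrightarrow>
     finite (verts S) \<and>
     (\<forall>e\<in>edges S. \<exists>u\<in>verts S. \<exists>v\<in>verts S. u \<noteq> v \<and> e = {u, v}) \<and>
     (\<forall>e\<in>edges S. esign S e = 1 \<or> esign S e = -1)"

definition listing :: "'a list \<Rightarrow> 'a set \<Rightarrow> bool" where
  "listing xs A \<longleftrightarrow> distinct xs \<and> set xs = A"

definition adj_matrix :: "'a list \<Rightarrow> 'a sgraph \<Rightarrow> int mat" where
  "adj_matrix vs S = mat (length vs) (length vs)
     (\<lambda>(i, j). if {vs ! i, vs ! j} \<in> edges S then esign S {vs ! i, vs ! j} else 0)"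

text \<open>
  The multiset of all complex roots of the characteristic polynomial, so that no
  eigenvalue is lost by definition.  The chosen ordering of the vertices
  does not matter, see \<open>sg_eigenvalues_listing\<close> below.
\<close>

definition sg_eigenvalues :: "'a sgraph \<Rightarrow> complex multiset" where
  "sg_eigenvalues S =
     proots (char_poly (map_mat of_int (adj_matrix (SOME vs. listing vs (verts S)) S)))"

definition energy :: "'a sgraph \<Rightarrow> real" where
  "energy S = (\<Sum>x\<in>#sg_eigenvalues S. cmod x)"

definition is_signed_path :: "nat \<Rightarrow> nat \<Rightarrow> 'a sgraph \<Rightarrow> bool" where
  "is_signed_path n r S \<longleftrightarrow>
     signed_graph S \<and>
     (\<exists>p. listing p (verts S) \<and> length p = n \<and>
          edges S = {{p ! i, p ! Suc i} | i. Suc i < n}) \<and>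
     card {e \<in> edges S. esign S e = -1} = r"

text \<open>
  An edge \<open>{(u, v), (u', v)}\<close> projects onto the edge \<open>{u, u'}\<close> of the first factor, whereas
  an edge \<open>{(u, v), (u, v')}\<close> projects onto the singleton \<open>{u}\<close>, which is never an edge.
\<close>

definition cart_prod :: "'a sgraph \<Rightarrow> 'b sgraph \<Rightarrow> ('a \<times> 'b) sgraph" where
  "cart_prod S T =
     \<lparr> verts = verts S \<times> verts T,
       edges = {{(u, v), (u', v)} | u u' v. {u, u'} \<in> edges S \<and> v \<in> verts T} \<union>
               {{(u, v), (u, v')} | u v v'. u \<in> verts S \<and> {v, v'} \<in> edges T},
       esign = (\<lambda>e. if fst ` e \<in> edges S then esign S (fst ` e) else esign T (snd ` e)) \<rparr>"

definition incidence_matrix :: "'a sgraph \<Rightarrow> 'a list \<Rightarrow> 'a set list \<Rightarrow> int mat \<Rightarrow> bool" where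
  "incidence_matrix S vs es H \<longleftrightarrow>
     H \<in> carrier_mat (length vs) (length es) \<and>
     (\<forall>i<length vs. \<forall>k<length es.
        (vs ! i \<notin> es ! k \<longrightarrow> H $$ (i, k) = 0) \<and>
        (vs ! i \<in> es ! k \<longrightarrow> H $$ (i, k) = 1 \<or> H $$ (i, k) = -1)) \<and>
     (\<forall>i<length vs. \<forall>j<length vs. \<forall>k<length es.
        es ! k = {vs ! i, vs ! j} \<longrightarrow> H $$ (i, k) * H $$ (j, k) = - esign S (es ! k))"

text \<open>
  A predicate rather than a function, because the signature depends on the choice of the
  incidence matrix.  Existence is \<open>ex_line_graph\<close> below.
\<close>

definition is_line_graph :: "'a sgraph \<Rightarrow> 'a set sgraph \<Rightarrow> bool" where
  "is_line_graph S L \<longleftrightarrow>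
     signed_graph L \<and>
     verts L = edges S \<and>
     edges L = {{e, f} | e f. e \<in> edges S \<and> f \<in> edges S \<and> e \<noteq> f \<and> e \<inter> f \<noteq> {}} \<and>
     (\<exists>vs es H. listing vs (verts S) \<and> listing es (edges S) \<and> incidence_matrix S vs es H \<and>
        adj_matrix es L = 2 \<cdot>\<^sub>m 1\<^sub>m (length es) - transpose_mat H * H)"


lemma ex_listing: "finite A \<Longrightarrow> \<exists>xs. listing xs A"
  unfolding listing_def using finite_distinct_list by metis

lemma adj_matrix_listing_similar:
  fixes S :: "'a sgraph"
  assumes xs: "listing xs A" and ys: "listing ys A"
  shows "similar_mat (map_mat of_int (adj_matrix xs S) :: complex mat)
                     (map_mat of_int (adj_matrix ys S))"
proof -
  define n where "n = card A"
  have n: "length xs = n" "length ys = n"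
    using xs ys distinct_card unfolding listing_def n_def by metis+
  define R where "R = (\<lambda>us ws :: 'a list. mat n n (\<lambda>(i, j). if us ! i = ws ! j then 1 else 0 :: complex))"
  define M where "M = (\<lambda>us :: 'a list. map_mat of_int (adj_matrix us S) :: complex mat)"
  have carr: "R us ws \<in> carrier_mat n n" for us ws by (simp add: R_def)
  have Mc: "M xs \<in> carrier_mat n n" "M ys \<in> carrier_mat n n"
    by (simp_all add: M_def adj_matrix_def n)
  have pick: "(\<Sum>k<n. (if c = ws ! k then 1 else 0) * h (ws ! k)) = (h c :: complex)"
    if ws: "listing ws A" "length ws = n" and c: "c \<in> A" for ws c h
  proof -
    have "bij_betw (nth ws) {..<n} A"
      using bij_betw_nth[of ws "{..<n}" A] ws unfolding listing_def by auto
    then have "(\<Sum>k<n. (if c = ws ! k then 1 else 0) * h (ws ! k))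
             = (\<Sum>x\<in>A. (if c = x then 1 else 0) * h x)"
      by (rule sum.reindex_bij_betw)
    also have "\<dots> = (\<Sum>x\<in>A. if c = x then h x else 0)" by (intro sum.cong) auto
    also have "\<dots> = h c" using c ws unfolding listing_def by (auto simp: sum.delta)
    finally show ?thesis .
  qed
  have inv: "R us ws * R ws us = 1\<^sub>m n"
    if us: "listing us A" "length us = n" and ws: "listing ws A" "length ws = n" for us ws
  proof (rule eq_matI)
    fix i j assume ij: "i < dim_row (1\<^sub>m n :: complex mat)" "j < dim_col (1\<^sub>m n :: complex mat)"
    then have "(R us ws * R ws us) $$ (i, j) =
        (\<Sum>k<n. (if us ! i = ws ! k then 1 else 0) * (if ws ! k = us ! j then 1 else 0))"
      by (simp add: R_def scalar_prod_def lessThan_atLeast0)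
    also have "\<dots> = (if us ! i = us ! j then 1 else 0)"
      using ij us by (subst pick[OF ws, of "us ! i" "\<lambda>x. if x = us ! j then 1 else 0"])
        (auto simp: listing_def)
    also have "\<dots> = 1\<^sub>m n $$ (i, j)"
      using ij us by (simp add: listing_def nth_eq_iff_index_eq)
    finally show "(R us ws * R ws us) $$ (i, j) = 1\<^sub>m n $$ (i, j)" .
  qed (simp_all add: R_def)
  have comm: "R xs ys * M ys = M xs * R xs ys"
  proof (rule eq_matI)
    fix i j assume "i < dim_row (M xs * R xs ys)" "j < dim_col (M xs * R xs ys)"
    then have ij: "i < n" "j < n" using Mc by (auto simp: R_def)
    define g where "g = (\<lambda>a b. of_int (if {a, b} \<in> edges S then esign S {a, b} else 0) :: complex)"
    have A: "xs ! i \<in> A" "ys ! j \<in> A" using ij xs ys n unfolding listing_def by (metis nth_mem)+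
    have "(R xs ys * M ys) $$ (i, j) =
        (\<Sum>k<n. (if xs ! i = ys ! k then 1 else 0) * g (ys ! k) (ys ! j))"
      using ij n by (simp add: R_def M_def g_def adj_matrix_def scalar_prod_def lessThan_atLeast0)
    also have "\<dots> = g (xs ! i) (ys ! j)"
      by (rule pick[OF ys n(2) A(1), of "\<lambda>x. g x (ys ! j)"])
    also have "\<dots> = (\<Sum>k<n. (if ys ! j = xs ! k then 1 else 0) * g (xs ! i) (xs ! k))"
      by (rule pick[OF xs n(1) A(2), symmetric])
    also have "\<dots> = (\<Sum>k<n. g (xs ! i) (xs ! k) * (if xs ! k = ys ! j then 1 else 0))"
      by (intro sum.cong) auto
    also have "\<dots> = (M xs * R xs ys) $$ (i, j)"
      using ij n by (simp add: R_def M_def g_def adj_matrix_def scalar_prod_def lessThan_atLeast0)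
    finally show "(R xs ys * M ys) $$ (i, j) = (M xs * R xs ys) $$ (i, j)" .
  qed (use Mc in \<open>auto simp: R_def\<close>)
  have "R xs ys * M ys * R ys xs = M xs * (R xs ys * R ys xs)"
    unfolding comm by (rule assoc_mult_mat[OF Mc(1) carr carr])
  also have "\<dots> = M xs" using inv[OF xs n(1) ys n(2)] Mc by simp
  finally have "similar_mat_wit (M xs) (M ys) (R xs ys) (R ys xs)"
    unfolding similar_mat_wit_def Let_def
    using inv[OF xs n(1) ys n(2)] inv[OF ys n(2) xs n(1)] Mc carr by auto
  then show ?thesis unfolding similar_mat_def M_def by blast
qed

lemma sg_eigenvalues_listing:
  assumes "listing vs (verts S)"
  shows "sg_eigenvalues S = proots (char_poly (map_mat of_int (adj_matrix vs S)))"
  unfolding sg_eigenvalues_def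
  using char_poly_similar[OF adj_matrix_listing_similar[OF someI[of "\<lambda>vs. listing vs (verts S)"] assms]]
    assms by metis

lemma signed_graph_cart_prod:
  assumes "signed_graph S" "signed_graph T"
  shows "signed_graph (cart_prod S T)"
proof -
  have vS: "u \<in> verts S \<and> u' \<in> verts S \<and> u \<noteq> u'" if "{u, u'} \<in> edges S" for u u'
    using assms(1) that unfolding signed_graph_def by (metis doubleton_eq_iff)
  have vT: "u \<in> verts T \<and> u' \<in> verts T \<and> u \<noteq> u'" if "{u, u'} \<in> edges T" for u u'
    using assms(2) that unfolding signed_graph_def by (metis doubleton_eq_iff)
  have "\<exists>x\<in>verts S \<times> verts T. \<exists>y\<in>verts S \<times> verts T. x \<noteq> y \<and> e = {x, y}"
    and "esign (cart_prod S T) e = 1 \<or> esign (cart_prod S T) e = -1"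
    if "e \<in> edges (cart_prod S T)" for e
  proof -
    from that consider
      (1) u u' v where "e = {(u, v), (u', v)}" "{u, u'} \<in> edges S" "v \<in> verts T"
    | (2) u v v' where "e = {(u, v), (u, v')}" "u \<in> verts S" "{v, v'} \<in> edges T"
      unfolding cart_prod_def by auto
    then have "(\<exists>x\<in>verts S \<times> verts T. \<exists>y\<in>verts S \<times> verts T. x \<noteq> y \<and> e = {x, y}) \<and>
      (esign (cart_prod S T) e = 1 \<or> esign (cart_prod S T) e = -1)"
    proof cases
      case 1
      then show ?thesis using vS[of u u'] assms(1) unfolding signed_graph_def cart_prod_def
        by (intro conjI bexI[of _ "(u, v)"] bexI[of _ "(u', v)"]) auto
    next
      case 2
      then show ?thesis using vT[of v v'] vS[of u u] assms(2) unfolding signed_graph_def cart_prod_def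
        by (intro conjI bexI[of _ "(u, v)"] bexI[of _ "(u, v')"]) auto
    qed
    then show "\<exists>x\<in>verts S \<times> verts T. \<exists>y\<in>verts S \<times> verts T. x \<noteq> y \<and> e = {x, y}"
      and "esign (cart_prod S T) e = 1 \<or> esign (cart_prod S T) e = -1" by auto
  qed
  then show ?thesis using assms unfolding signed_graph_def by (auto simp: cart_prod_def)
qed

lemma ex_line_graph:
  fixes S :: "'a sgraph"
  assumes S: "signed_graph S"
  shows "\<exists>L. is_line_graph S L"
proof -
  obtain vs where vs: "listing vs (verts S)" using ex_listing S unfolding signed_graph_def by metis
  have two: "\<exists>u\<in>verts S. \<exists>v\<in>verts S. u \<noteq> v \<and> e = {u, v}" if "e \<in> edges S" for e
    using S that unfolding signed_graph_def by blast
  then have "edges S \<subseteq> Pow (verts S)" by fastforce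
  moreover have finV: "finite (verts S)" using S unfolding signed_graph_def by simp
  ultimately have finE: "finite (edges S)" using finite_subset by auto
  then obtain es where es: "listing es (edges S)" using ex_listing by metis
  define h where "h = (\<lambda>e :: 'a set. SOME u. u \<in> e)"
  define eta where "eta = (\<lambda>(v :: 'a) e. if v \<notin> e then 0 else if v = h e then 1 else - esign S e)"
  have h: "h e \<in> e" if "e \<in> edges S" for e
    unfolding h_def using two[OF that] by (metis insertI1 someI)
  have sg: "esign S e = 1 \<or> esign S e = -1" if "e \<in> edges S" for e
    using S that unfolding signed_graph_def by blast
  have eta1: "eta v e = 1 \<or> eta v e = -1" if "e \<in> edges S" "v \<in> e" for v e
    using sg[OF that(1)] that unfolding eta_def by auto
  have eta2: "eta u e * eta v e = - esign S e" if "e \<in> edges S" "e = {u, v}" for u v e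
  proof -
    have "u \<noteq> v" using two[OF that(1)] that(2) by auto
    then show ?thesis using h[OF that(1)] that(2) unfolding eta_def by auto
  qed
  define H where "H = mat (length vs) (length es) (\<lambda>(i, k). eta (vs ! i) (es ! k))"
  define L where "L = \<lparr> verts = edges S,
      edges = {{e, f} | e f. e \<in> edges S \<and> f \<in> edges S \<and> e \<noteq> f \<and> e \<inter> f \<noteq> {}},
      esign = (\<lambda>g. - (\<Sum>v\<in>verts S. \<Prod>e\<in>g. eta v e)) \<rparr>"
  have prods: "(\<Sum>v\<in>verts S. eta v e * eta v f) = 1 \<or> (\<Sum>v\<in>verts S. eta v e * eta v f) = -1"
    if ef: "e \<in> edges S" "f \<in> edges S" "e \<noteq> f" "e \<inter> f \<noteq> {}" for e f
  proof -
    obtain w where w: "w \<in> e" "w \<in> f" using ef by auto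
    have wV: "w \<in> verts S" using two[OF ef(1)] w by auto
    have "v \<notin> e \<or> v \<notin> f" if "v \<noteq> w" for v
      using two[OF ef(1)] two[OF ef(2)] w that ef(3) by auto
    then have "eta v e * eta v f = 0" if "v \<noteq> w" for v using that unfolding eta_def by auto
    then have "(\<Sum>v\<in>verts S. eta v e * eta v f) = (\<Sum>v\<in>{w}. eta v e * eta v f)"
      using wV finV by (intro sum.mono_neutral_right) auto
    then show ?thesis using eta1[OF ef(1) w(1)] eta1[OF ef(2) w(2)] by auto
  qed
  have diag: "(\<Sum>v\<in>verts S. eta v e * eta v e) = 2" if e: "e \<in> edges S" for e
  proof -
    obtain a b where ab: "a \<in> verts S" "b \<in> verts S" "a \<noteq> b" "e = {a, b}" using two[OF e] by blast
    have "(\<Sum>v\<in>verts S. eta v e * eta v e) = (\<Sum>v\<in>{a, b}. eta v e * eta v e)"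
      using ab finV by (intro sum.mono_neutral_right) (auto simp: eta_def)
    also have "\<dots> = 2" using ab eta1[OF e, of a] eta1[OF e, of b] by auto
    finally show ?thesis .
  qed
  have off: "(\<Sum>v\<in>verts S. eta v e * eta v f) = 0" if "e \<inter> f = {}" for e f
    using that by (intro sum.neutral) (auto simp: eta_def)
  have signL: "esign L {e, f} = - (\<Sum>v\<in>verts S. eta v e * eta v f)" if "e \<noteq> f" for e f
    using that by (simp add: L_def)
  have edgeL: "{e, f} \<in> edges L \<longleftrightarrow> e \<in> edges S \<and> f \<in> edges S \<and> e \<noteq> f \<and> e \<inter> f \<noteq> {}" for e f
    unfolding L_def by (auto simp: doubleton_eq_iff)
  have sgL: "signed_graph L"
    unfolding signed_graph_def
  proof (intro conjI ballI)
    show "finite (verts L)" using finE by (simp add: L_def)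
  next
    fix g assume "g \<in> edges L"
    then obtain e f where ef: "g = {e, f}" "e \<in> edges S" "f \<in> edges S" "e \<noteq> f" "e \<inter> f \<noteq> {}"
      unfolding L_def by auto
    then show "\<exists>u\<in>verts L. \<exists>v\<in>verts L. u \<noteq> v \<and> g = {u, v}" unfolding L_def by auto
    show "esign L g = 1 \<or> esign L g = - 1"
      using signL[OF ef(4)] prods[OF ef(2-5)] ef(1) by auto
  qed
  have inc: "incidence_matrix S vs es H"
    unfolding incidence_matrix_def
  proof (intro conjI allI impI)
    show "H \<in> carrier_mat (length vs) (length es)" by (simp add: H_def)
  next
    fix i k assume ik: "i < length vs" "k < length es"
    then have e: "es ! k \<in> edges S" using es nth_mem unfolding listing_def by metis
    show "H $$ (i, k) = 0" if "vs ! i \<notin> es ! k" using ik that by (simp add: H_def eta_def)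
    show "H $$ (i, k) = 1 \<or> H $$ (i, k) = -1" if "vs ! i \<in> es ! k"
      using ik eta1[OF e that] by (simp add: H_def)
  next
    fix i j k assume ijk: "i < length vs" "j < length vs" "k < length es" "es ! k = {vs ! i, vs ! j}"
    then have e: "es ! k \<in> edges S" using es nth_mem unfolding listing_def by metis
    show "H $$ (i, k) * H $$ (j, k) = - esign S (es ! k)"
      using ijk(1-3) eta2[OF e ijk(4)] by (simp add: H_def)
  qed
  have "adj_matrix es L = 2 \<cdot>\<^sub>m 1\<^sub>m (length es) - transpose_mat H * H"
  proof (rule eq_matI)
    fix i j assume "i < dim_row (2 \<cdot>\<^sub>m 1\<^sub>m (length es) - transpose_mat H * H)"
      "j < dim_col (2 \<cdot>\<^sub>m 1\<^sub>m (length es) - transpose_mat H * H)"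
    then have ij: "i < length es" "j < length es" by (auto simp: H_def)
    have e: "es ! i \<in> edges S" "es ! j \<in> edges S" using ij es unfolding listing_def by (metis nth_mem)+
    have "bij_betw (nth vs) {..<length vs} (verts S)"
      using bij_betw_nth[of vs "{..<length vs}" "verts S"] vs unfolding listing_def by auto
    then have s: "(\<Sum>k<length vs. eta (vs ! k) (es ! i) * eta (vs ! k) (es ! j))
        = (\<Sum>v\<in>verts S. eta v (es ! i) * eta v (es ! j))"
      by (rule sum.reindex_bij_betw)
    have "(transpose_mat H * H) $$ (i, j) = (\<Sum>v\<in>verts S. eta v (es ! i) * eta v (es ! j))"
      using ij s by (simp add: H_def scalar_prod_def lessThan_atLeast0)
    moreover have "i = j \<longleftrightarrow> es ! i = es ! j"
      using ij es unfolding listing_def by (simp add: nth_eq_iff_index_eq)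
    ultimately show "adj_matrix es L $$ (i, j) =
        (2 \<cdot>\<^sub>m 1\<^sub>m (length es) - transpose_mat H * H) $$ (i, j)"
      using ij e diag[OF e(1)] off[of "es ! i" "es ! j"] signL[of "es ! i" "es ! j"]
        edgeL[of "es ! i" "es ! j"]
      by (cases "i = j") (auto simp: adj_matrix_def H_def)
  qed (auto simp: adj_matrix_def H_def)
  then have "is_line_graph S L"
    unfolding is_line_graph_def using sgL vs es inc by (auto simp: L_def)
  then show ?thesis by blast
qed

end

theory Submission
  imports Defs
begin

text \<open>
  If \<open>H\<close> is an incidence matrix of a signed graph, then \<open>H H\<^sup>T\<close> is its signed Laplacian, and
  \<open>2 I - H H\<^sup>T\<close> and \<open>2 I - H\<^sup>T H\<close> have the same spectrum up to copies of the eigenvalue \<open>2\<close>.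
  The signed Laplacian of a Cartesian product is the Kronecker sum of those of the factors, so that
  products of eigenvectors of the factors diagonalise it. A signed path is switching equivalent
  to the all-negative path, whose Laplacian has the eigenvectors
  \<open>i \<mapsto> sin (\<pi> k (2 i + 1) / (2 n))\<close> with the distinct eigenvalues \<open>2 + 2 cos (\<pi> k / n)\<close>,
  \<open>1 \<le> k \<le> n\<close>; being symmetric, it has orthogonal eigenvectors for distinct eigenvalues.
\<close>

subsection \<open>Characteristic polynomials\<close>

text \<open>Passing to the characteristic matrix only negates \<open>C\<close> as a block of
  constant polynomials, so the zero block survives and the determinant factors over the two diagonal
  blocks.\<close>

lemma char_poly_block_upper_right_zero:
  fixes A D :: "'a :: idom mat"
  assumes A: "A \<in> carrier_mat n n" and C: "C \<in> carrier_mat m n" and D: "D \<in> carrier_mat m m"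
  shows "char_poly (four_block_mat A (0\<^sub>m n m) C D) = char_poly A * char_poly D"
proof -
  have "char_poly_matrix (four_block_mat A (0\<^sub>m n m) C D) =
      four_block_mat (char_poly_matrix A) (0\<^sub>m n m) (map_mat (\<lambda>a. [:- a:]) C) (char_poly_matrix D)"
    by (rule eq_matI) (use A C D in \<open>auto simp: char_poly_matrix_def\<close>)
  then show ?thesis
    unfolding char_poly_def using A C D
    by (simp add: det_four_block_mat_upper_right_zero[where n = n and m = m])
qed

lemma char_poly_smult_one:
  "char_poly (c \<cdot>\<^sub>m 1\<^sub>m n :: 'a :: comm_ring_1 mat) = [:- c, 1:] ^ n"
proof -
  have "upper_triangular (c \<cdot>\<^sub>m 1\<^sub>m n)" by auto
  moreover have "diag_mat (c \<cdot>\<^sub>m 1\<^sub>m n) = replicate n c"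
    by (auto simp: diag_mat_def list_eq_iff_nth_eq)
  ultimately show ?thesis
    using char_poly_upper_triangular[of "c \<cdot>\<^sub>m 1\<^sub>m n" n] by simp
qed

text \<open>A Sylvester-type identity, obtained from two similar block triangular matrices with a
  common lower left block \<open>B\<close>. The sizes \<open>p\<close> and \<open>q\<close> are
  unrelated, so powers of the linear factor stand on both sides and nothing is divided.\<close>

lemma char_poly_scalar_minus_mult_commute:
  fixes A B :: "'a :: idom mat"
  assumes A: "A \<in> carrier_mat p q" and B: "B \<in> carrier_mat q p"
  shows "char_poly (c \<cdot>\<^sub>m 1\<^sub>m p - A * B) * [:- c, 1:] ^ q =
    [:- c, 1:] ^ p * char_poly (c \<cdot>\<^sub>m 1\<^sub>m q - B * A)"
proof -
  \<comment> \<open>The diagonal blocks of \<open>X\<close> and \<open>Y\<close> carry the two sides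
    of the identity. The unipotent matrix \<open>S\<close>, with inverse \<open>T\<close>, satisfies
    \<open>X * S = S * Y\<close>.\<close>
  define X where "X = four_block_mat (c \<cdot>\<^sub>m 1\<^sub>m p - A * B) (0\<^sub>m p q) B (c \<cdot>\<^sub>m 1\<^sub>m q)"
  define Y where "Y = four_block_mat (c \<cdot>\<^sub>m 1\<^sub>m p) (0\<^sub>m p q) B (c \<cdot>\<^sub>m 1\<^sub>m q - B * A)"
  define S where "S = four_block_mat (1\<^sub>m p) (- A) (0\<^sub>m q p) (1\<^sub>m q)"
  define T where "T = four_block_mat (1\<^sub>m p) A (0\<^sub>m q p) (1\<^sub>m q)"
  have carr: "X \<in> carrier_mat (p+q) (p+q)" "Y \<in> carrier_mat (p+q) (p+q)"
    "S \<in> carrier_mat (p+q) (p+q)" "T \<in> carrier_mat (p+q) (p+q)"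
    using A B by (auto simp: X_def Y_def S_def T_def)
  have z: "- 0\<^sub>m q q + 1\<^sub>m q = (1\<^sub>m q :: 'a mat)"
    by (rule eq_matI) auto
  have ST: "S * T = 1\<^sub>m (p+q)"
    unfolding S_def T_def
    by (subst mult_four_block_mat[of _ p p _ q _ q _ _ p _ q])
      (use A in \<open>auto simp: uminus_l_inv_mat comm_add_mat[OF A uminus_carrier_mat[OF A]] z\<close>)
  have TS: "T * S = 1\<^sub>m (p+q)"
    unfolding S_def T_def
    by (subst mult_four_block_mat[of _ p p _ q _ q _ _ p _ q])
      (use A in \<open>auto simp: uminus_l_inv_mat z\<close>)
  have AB: "A * B \<in> carrier_mat p p" "B * A \<in> carrier_mat q q" using A B by auto
  have SY: "S * Y = four_block_mat (c \<cdot>\<^sub>m 1\<^sub>m p - A * B) (- A * (c \<cdot>\<^sub>m 1\<^sub>m q - B * A)) B (c \<cdot>\<^sub>m 1\<^sub>m q - B * A)"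
    unfolding S_def Y_def
    by (subst mult_four_block_mat[of _ p p _ q _ q _ _ p _ q])
      (use A B AB in \<open>auto intro!: cong_four_block_mat simp: minus_add_uminus_mat[of _ p p]\<close>)
  have XS: "X * S = four_block_mat (c \<cdot>\<^sub>m 1\<^sub>m p - A * B) ((c \<cdot>\<^sub>m 1\<^sub>m p - A * B) * - A) B (B * - A + c \<cdot>\<^sub>m 1\<^sub>m q)"
    unfolding S_def X_def
    by (subst mult_four_block_mat[of _ p p _ q _ q _ _ p _ q])
      (use A B AB in \<open>auto intro!: cong_four_block_mat\<close>)
  \<comment> \<open>The upper right blocks of \<open>S * Y\<close> and \<open>X * S\<close> agree,
    since both equal \<open>A * B * A\<close> minus \<open>c\<close> times \<open>A\<close>.\<close>
  have 1: "- A * (c \<cdot>\<^sub>m 1\<^sub>m q - B * A) = (c \<cdot>\<^sub>m 1\<^sub>m p - A * B) * - A"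
  proof -
    have nA: "- A \<in> carrier_mat p q" using A by simp
    have "- A * (c \<cdot>\<^sub>m 1\<^sub>m q - B * A) = - A * (c \<cdot>\<^sub>m 1\<^sub>m q) - - A * (B * A)"
      by (rule mult_minus_distrib_mat[OF nA _ AB(2)]) simp
    also have "- A * (c \<cdot>\<^sub>m 1\<^sub>m q) = c \<cdot>\<^sub>m - A"
      using mult_smult_distrib[OF nA one_carrier_mat, of c] nA by simp
    also have "c \<cdot>\<^sub>m - A = (c \<cdot>\<^sub>m 1\<^sub>m p) * - A"
      using mult_smult_assoc_mat[OF one_carrier_mat nA, of c] nA by simp
    also have "- A * (B * A) = (A * B) * - A"
      using A B AB by (simp add: assoc_mult_mat[OF A B nA] uminus_mult_left_mat uminus_mult_right_mat)
    also have "(c \<cdot>\<^sub>m 1\<^sub>m p) * - A - (A * B) * - A = (c \<cdot>\<^sub>m 1\<^sub>m p - A * B) * - A"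
      by (rule minus_mult_distrib_mat[OF _ AB(1) nA, symmetric]) simp
    finally show ?thesis .
  qed
  have 2: "B * - A + c \<cdot>\<^sub>m 1\<^sub>m q = c \<cdot>\<^sub>m 1\<^sub>m q - B * A"
    by (rule eq_matI) (use A B AB in auto)
  have "X * S = S * Y" unfolding SY XS 1 2 ..
  then have "X = S * Y * T"
    using assoc_mult_mat[OF carr(1,3,4)] ST carr by simp
  then have "similar_mat_wit X Y S T"
    unfolding similar_mat_wit_def Let_def using ST TS carr by auto
  then have "char_poly X = char_poly Y"
    using char_poly_similar unfolding similar_mat_def by blast
  moreover have "char_poly X = char_poly (c \<cdot>\<^sub>m 1\<^sub>m p - A * B) * [:- c, 1:] ^ q"
    unfolding X_def
    by (subst char_poly_block_upper_right_zero[OF minus_carrier_mat[OF AB(1)] B])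
      (simp_all add: char_poly_smult_one)
  moreover have "char_poly Y = [:- c, 1:] ^ p * char_poly (c \<cdot>\<^sub>m 1\<^sub>m q - B * A)"
    unfolding Y_def
    by (subst char_poly_block_upper_right_zero[OF _ B minus_carrier_mat[OF AB(2)]])
      (simp_all add: char_poly_smult_one)
  ultimately show ?thesis by simp
qed

lemma sum_nth_listing:
  assumes "listing xs A"
  shows "(\<Sum>i<length xs. h (xs ! i)) = (\<Sum>x\<in>A. h x)"
proof -
  have "bij_betw (nth xs) {..<length xs} A"
    using bij_betw_nth[of xs "{..<length xs}" A] assms unfolding listing_def by auto
  then show ?thesis by (rule sum.reindex_bij_betw)
qed

text \<open>The eigenvectors form the columns of an orthogonal matrix \<open>U\<close>, and
  conjugation by \<open>U\<close> diagonalises. Orthonormality refers to the bilinear form without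
  conjugation, so any field will do; the index set \<open>K\<close> has its own type, so that
  eigenvectors can later be indexed by pairs.\<close>

lemma char_poly_orthonormal_eigenbasis:
  fixes g :: "'a \<Rightarrow> 'a \<Rightarrow> 'c :: field" and F :: "'a \<Rightarrow> 'k \<Rightarrow> 'c"
  assumes vs: "listing vs V" and ks: "listing ks K" and card: "card K = card V"
    and ortho: "\<And>k l. k \<in> K \<Longrightarrow> l \<in> K \<Longrightarrow> (\<Sum>x\<in>V. F x k * F x l) = of_bool (k = l)"
    and eigen: "\<And>x k. x \<in> V \<Longrightarrow> k \<in> K \<Longrightarrow> (\<Sum>y\<in>V. g x y * F y k) = \<mu> k * F x k"
  shows "char_poly (mat (length vs) (length vs) (\<lambda>(i, j). g (vs ! i) (vs ! j))) =
    (\<Prod>k\<in>K. [:- \<mu> k, 1:])"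
proof -
  define n where "n = length vs"
  have len: "length vs = n" "length ks = n"
    using vs ks card distinct_card unfolding listing_def n_def by metis+
  have mem: "vs ! i \<in> V" "ks ! i \<in> K" if "i < n" for i
    using vs ks len that unfolding listing_def by (metis nth_mem)+
  have inj: "ks ! i = ks ! j \<longleftrightarrow> i = j" if "i < n" "j < n" for i j
    using ks len that unfolding listing_def by (simp add: nth_eq_iff_index_eq)
  have sumV: "(\<Sum>i = 0..<n. h (vs ! i)) = (\<Sum>x\<in>V. h x)" for h :: "'a \<Rightarrow> 'c"
    using sum_nth_listing[OF vs, of h] len by (simp add: lessThan_atLeast0)
  define M where "M = mat n n (\<lambda>(i, j). g (vs ! i) (vs ! j))"
  define U where "U = mat n n (\<lambda>(i, k). F (vs ! i) (ks ! k))"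
  define D where "D = mat n n (\<lambda>(k, l). if k = l then \<mu> (ks ! k) else 0)"
  have carr: "M \<in> carrier_mat n n" "U \<in> carrier_mat n n" "D \<in> carrier_mat n n"
    "transpose_mat U \<in> carrier_mat n n"
    by (simp_all add: M_def U_def D_def)
  have UTU: "transpose_mat U * U = 1\<^sub>m n"
    by (rule eq_matI)
      (auto simp: U_def scalar_prod_def inj mem ortho sumV[of "\<lambda>x. F x (ks ! _) * F x (ks ! _)"])
  \<comment> \<open>Equal cardinalities of \<open>K\<close> and \<open>V\<close> make
    \<open>U\<close> square, so its left inverse is also a right inverse.\<close>
  then have UUT: "U * transpose_mat U = 1\<^sub>m n"
    using mat_mult_left_right_inverse carr by blast
  have MU: "M * U = U * D"
  proof (rule eq_matI)
    fix i j assume "i < dim_row (U * D)" "j < dim_col (U * D)"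
    then have ij: "i < n" "j < n" by (auto simp: U_def D_def)
    have "(M * U) $$ (i, j) = (\<Sum>y\<in>V. g (vs ! i) y * F y (ks ! j))"
      using ij by (simp add: M_def U_def scalar_prod_def
          sumV[of "\<lambda>y. g (vs ! i) y * F y (ks ! j)"])
    also have "\<dots> = F (vs ! i) (ks ! j) * \<mu> (ks ! j)"
      using eigen mem ij by simp
    also have "\<dots> = (U * D) $$ (i, j)"
      using ij by (simp add: U_def D_def scalar_prod_def if_distrib[of "\<lambda>x. _ * x"] cong: if_cong)
    finally show "(M * U) $$ (i, j) = (U * D) $$ (i, j)" .
  qed (simp_all add: M_def U_def D_def)
  have "M = M * (U * transpose_mat U)" using UUT carr by simp
  also have "\<dots> = U * D * transpose_mat U"
    using MU by (simp add: assoc_mult_mat[OF carr(1,2,4), symmetric])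
  finally have "similar_mat_wit M D U (transpose_mat U)"
    unfolding similar_mat_wit_def Let_def using UTU UUT carr by auto
  then have "char_poly M = char_poly D"
    using char_poly_similar unfolding similar_mat_def by blast
  also have "\<dots> = (\<Prod>a\<leftarrow>diag_mat D. [:- a, 1:])"
    by (rule char_poly_upper_triangular[OF carr(3)]) (auto simp: D_def)
  also have "diag_mat D = map \<mu> ks"
    by (auto simp: diag_mat_def D_def list_eq_iff_nth_eq len)
  also have "(\<Prod>a\<leftarrow>map \<mu> ks. [:- a, 1:]) = (\<Prod>k\<in>K. [:- \<mu> k, 1:])"
    using ks unfolding listing_def by (auto simp: prod.distinct_set_conv_list o_def)
  finally show ?thesis unfolding M_def n_def .
qed

subsection \<open>The signed Laplacian and the line graph\<close>

text \<open>Degree matrix minus signed adjacency matrix. It is indexed by vertices instead of list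
  positions, so that sums over a product vertex set split without a chosen ordering.\<close>

definition signed_laplacian :: "'a sgraph \<Rightarrow> 'a \<Rightarrow> 'a \<Rightarrow> int" where
  "signed_laplacian S x y =
     (if x = y then int (card {e \<in> edges S. x \<in> e})
      else if {x, y} \<in> edges S then - esign S {x, y} else 0)"

lemma signed_laplacian_commute: "signed_laplacian S x y = signed_laplacian S y x"
proof (cases "x = y")
  case False
  moreover have "{x, y} = {y, x}" by blast
  ultimately show ?thesis by (simp add: signed_laplacian_def)
qed simp

section \<open>Edges of a signed graph as two-element vertex sets\<close>

lemma signed_graph_finite_verts: "signed_graph S \<Longrightarrow> finite (verts S)"
  unfolding signed_graph_def by (elim conjE)

lemma signed_graph_edgeE:
  assumes "signed_graph S" "e \<in> edges S"
  obtains u v where "u \<in> verts S" "v \<in> verts S" "u \<noteq> v" "e = {u, v}"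
proof -
  have "\<exists>u\<in>verts S. \<exists>v\<in>verts S. u \<noteq> v \<and> e = {u, v}"
    using assms unfolding signed_graph_def by blast
  then show thesis using that by (elim bexE conjE)
qed

lemma signed_graph_edgeD:
  assumes "signed_graph S" "{x, y} \<in> edges S"
  shows "x \<in> verts S \<and> y \<in> verts S \<and> x \<noteq> y"
proof -
  obtain u v where "u \<in> verts S" "v \<in> verts S" "u \<noteq> v" "{x, y} = {u, v}"
    using assms by (rule signed_graph_edgeE)
  then show ?thesis by (auto simp: doubleton_eq_iff)
qed

lemma signed_graph_edge_eq:
  assumes S: "signed_graph S" and e: "e \<in> edges S" and xy: "x \<in> e" "y \<in> e" "x \<noteq> y"
  shows "e = {x, y}"
proof -
  obtain u v where "e = {u, v}" using S e by (rule signed_graph_edgeE)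
  then show ?thesis using xy by auto
qed

lemma finite_edges:
  assumes "signed_graph S"
  shows "finite (edges S)"
proof (rule finite_subset)
  show "edges S \<subseteq> Pow (verts S)"
  proof
    fix e assume "e \<in> edges S"
    then obtain u v where "u \<in> verts S" "v \<in> verts S" "e = {u, v}"
      using signed_graph_edgeE[OF assms] by metis
    then show "e \<in> Pow (verts S)" by simp
  qed
  show "finite (Pow (verts S))" using signed_graph_finite_verts[OF assms] by simp
qed

text \<open>Two rows of \<open>H\<close> meet only in columns of edges containing both vertices.
  Distinct vertices share at most one edge, whose column contributes minus its sign; on the diagonal
  every incident edge contributes the square of a unit, which adds up to the degree.\<close>

lemma incidence_matrix_mult_transpose:
  assumes S: "signed_graph S" and vs: "listing vs (verts S)" and es: "listing es (edges S)"
    and H: "incidence_matrix S vs es H"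
  shows "H * transpose_mat H =
    mat (length vs) (length vs) (\<lambda>(i, j). signed_laplacian S (vs ! i) (vs ! j))"
proof (rule eq_matI)
  have Hc: "H \<in> carrier_mat (length vs) (length es)"
    using H unfolding incidence_matrix_def by simp
  fix i j assume "i < dim_row (mat (length vs) (length vs) (\<lambda>(i, j). signed_laplacian S (vs ! i) (vs ! j)))"
    "j < dim_col (mat (length vs) (length vs) (\<lambda>(i, j). signed_laplacian S (vs ! i) (vs ! j)))"
  then have ij: "i < length vs" "j < length vs" by auto
  have H0: "H $$ (i, k) = 0" if "i < length vs" "k < length es" "vs ! i \<notin> es ! k" for i k
    using H that unfolding incidence_matrix_def by blast
  have H1: "H $$ (i, k) = 1 \<or> H $$ (i, k) = -1"
    if "i < length vs" "k < length es" "vs ! i \<in> es ! k" for i k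
    using H that unfolding incidence_matrix_def by blast
  have H2: "H $$ (i, k) * H $$ (j, k) = - esign S (es ! k)"
    if "k < length es" "es ! k = {vs ! i, vs ! j}" for k
    using H ij that unfolding incidence_matrix_def by blast
  have entry: "H $$ (i, k) * H $$ (j, k) =
      (if vs ! i \<in> es ! k \<and> vs ! j \<in> es ! k then
        if i = j then 1 else - esign S (es ! k) else 0)" if k: "k < length es" for k
  proof -
    consider "vs ! i \<notin> es ! k \<or> vs ! j \<notin> es ! k" | "i = j" "vs ! i \<in> es ! k"
      | "i \<noteq> j" "vs ! i \<in> es ! k" "vs ! j \<in> es ! k" by blast
    then show ?thesis
    proof cases
      case 1
      then show ?thesis using H0[OF ij(1) k] H0[OF ij(2) k] by auto
    next
      case 2
      then show ?thesis using H1[OF ij(2) k] by auto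
    next
      case 3
      have "es ! k \<in> edges S" using es k unfolding listing_def by (metis nth_mem)
      moreover have "vs ! i \<noteq> vs ! j"
        using vs ij 3 unfolding listing_def by (simp add: nth_eq_iff_index_eq)
      ultimately have "es ! k = {vs ! i, vs ! j}"
        using signed_graph_edge_eq[OF S] 3 by blast
      then show ?thesis using H2[OF k] 3 by simp
    qed
  qed
  have inj: "vs ! i = vs ! j \<longleftrightarrow> i = j"
    using vs ij unfolding listing_def by (simp add: nth_eq_iff_index_eq)
  have fin: "finite (edges S)" using S by (rule finite_edges)
  have "(H * transpose_mat H) $$ (i, j) = (\<Sum>k<length es. H $$ (i, k) * H $$ (j, k))"
    using ij Hc by (simp add: scalar_prod_def lessThan_atLeast0)
  also have "\<dots> = (\<Sum>k<length es. if vs ! i \<in> es ! k \<and> vs ! j \<in> es ! k then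
        if i = j then 1 else - esign S (es ! k) else 0)"
    using entry by (intro sum.cong) auto
  also have "\<dots> = (\<Sum>e\<in>edges S. if vs ! i \<in> e \<and> vs ! j \<in> e then
        if i = j then 1 else - esign S e else 0)"
    by (rule sum_nth_listing[OF es])
  also have "\<dots> = (\<Sum>e\<in>{e \<in> edges S. vs ! i \<in> e \<and> vs ! j \<in> e}. if i = j then 1 else - esign S e)"
    by (simp add: sum.inter_filter[OF fin])
  also have "\<dots> = signed_laplacian S (vs ! i) (vs ! j)"
  proof (cases "i = j")
    case True
    then show ?thesis by (simp add: signed_laplacian_def)
  next
    case False
    then have ne: "vs ! i \<noteq> vs ! j" using inj by simp
    have "{e \<in> edges S. vs ! i \<in> e \<and> vs ! j \<in> e} = {e \<in> edges S. e = {vs ! i, vs ! j}}"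
      using signed_graph_edge_eq[OF S _ _ _ ne] by (intro Collect_cong) blast
    also have "\<dots> = (if {vs ! i, vs ! j} \<in> edges S then {{vs ! i, vs ! j}} else {})"
      by auto
    finally have "{e \<in> edges S. vs ! i \<in> e \<and> vs ! j \<in> e} =
        (if {vs ! i, vs ! j} \<in> edges S then {{vs ! i, vs ! j}} else {})" .
    then show ?thesis using False ne by (simp add: signed_laplacian_def)
  qed
  finally show "(H * transpose_mat H) $$ (i, j) =
      mat (length vs) (length vs) (\<lambda>(i, j). signed_laplacian S (vs ! i) (vs ! j)) $$ (i, j)"
    using ij by simp
qed (use H[unfolded incidence_matrix_def, THEN conjunct1] in auto)

text \<open>The commutation identity with \<open>c = 2\<close> transfers the spectrum from
  \<open>H * transpose_mat H\<close> to \<open>transpose_mat H * H\<close>. The first product is the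
  signed Laplacian for every incidence matrix \<open>H\<close>, so the choice of \<open>H\<close>
  behind \<open>L\<close> drops out. The surplus of edges over vertices turns into copies of the
  eigenvalue 2.\<close>

lemma sg_eigenvalues_line_graph:
  fixes F :: "'a \<Rightarrow> 'k \<Rightarrow> real"
  assumes S: "signed_graph S" and L: "is_line_graph S L"
    and K: "finite K" "card K = card (verts S)"
    and ortho: "\<And>k l. k \<in> K \<Longrightarrow> l \<in> K \<Longrightarrow> (\<Sum>x\<in>verts S. F x k * F x l) = of_bool (k = l)"
    and eigen: "\<And>x k. x \<in> verts S \<Longrightarrow> k \<in> K \<Longrightarrow>
      (\<Sum>y\<in>verts S. of_int (signed_laplacian S x y) * F y k) = \<mu> k * F x k"
    and le: "card (verts S) \<le> card (edges S)"
  shows "sg_eigenvalues L = image_mset (\<lambda>k. complex_of_real (2 - \<mu> k)) (mset_set K)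
    + replicate_mset (card (edges S) - card (verts S)) 2"
proof -
  obtain vs es H where vs: "listing vs (verts S)" and es: "listing es (edges S)"
    and H: "incidence_matrix S vs es H"
    and adj: "adj_matrix es L = 2 \<cdot>\<^sub>m 1\<^sub>m (length es) - transpose_mat H * H"
    and vL: "verts L = edges S"
    using L unfolding is_line_graph_def by (elim conjE exE) (rule that)
  obtain ks where ks: "listing ks K" using ex_listing K by blast
  define p where "p = card (verts S)"
  define q where "q = card (edges S)"
  have len: "length vs = p" "length es = q"
    using vs es distinct_card unfolding listing_def p_def q_def by metis+
  have Hc: "H \<in> carrier_mat p q"
    using H len unfolding incidence_matrix_def by simp
  define C where "C = map_mat complex_of_int H"
  have Cc: "C \<in> carrier_mat p q" using Hc by (simp add: C_def)
  have inj: "vs ! i = vs ! j \<longleftrightarrow> i = j" if "i < p" "j < p" for i j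
    using vs len that unfolding listing_def by (simp add: nth_eq_iff_index_eq)
  \<comment> \<open>Entries of twice the identity minus the Laplacian: the eigenvectors stay the
    same and \<open>\<mu> k\<close> becomes \<open>2 - \<mu> k\<close>.\<close>
  define g where "g = (\<lambda>x y. complex_of_real (2 * of_bool (x = y) - of_int (signed_laplacian S x y)))"
  have HH: "map_mat of_int (H * transpose_mat H) = C * transpose_mat C"
    using of_int_hom.mat_hom_mult[OF Hc, of "transpose_mat H" p] Hc
    by (simp add: C_def map_mat_transpose)
  have HH': "map_mat of_int (transpose_mat H * H) = transpose_mat C * C"
    using of_int_hom.mat_hom_mult[OF transpose_carrier_mat[THEN iffD2, OF Hc] Hc] Hc
    by (simp add: C_def map_mat_transpose)
  have "mat p p (\<lambda>(i, j). g (vs ! i) (vs ! j)) = 2 \<cdot>\<^sub>m 1\<^sub>m p - C * transpose_mat C"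
    unfolding HH[symmetric] incidence_matrix_mult_transpose[OF S vs es H]
    by (rule eq_matI) (auto simp: g_def len inj)
  moreover have "char_poly (mat p p (\<lambda>(i, j). g (vs ! i) (vs ! j))) =
      (\<Prod>k\<in>K. [:- complex_of_real (2 - \<mu> k), 1:])"
    unfolding len(1)[symmetric]
  proof (rule char_poly_orthonormal_eigenbasis[OF vs ks K(2), where F = "\<lambda>x k. complex_of_real (F x k)"])
    fix k l assume "k \<in> K" "l \<in> K"
    then have "complex_of_real (\<Sum>x\<in>verts S. F x k * F x l) = of_bool (k = l)"
      using ortho by simp
    then show "(\<Sum>x\<in>verts S. complex_of_real (F x k) * complex_of_real (F x l)) = of_bool (k = l)"
      by simp
  next
    fix x k assume xk: "x \<in> verts S" "k \<in> K"
    have fin: "finite (verts S)" using S by (rule signed_graph_finite_verts)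
    have "(\<Sum>y\<in>verts S. (2 * of_bool (x = y) - of_int (signed_laplacian S x y)) * F y k) =
        (\<Sum>y\<in>verts S. if x = y then 2 * F y k else 0)
        - (\<Sum>y\<in>verts S. of_int (signed_laplacian S x y) * F y k)"
      unfolding sum_subtractf[symmetric] by (intro sum.cong) (auto simp: algebra_simps)
    also have "\<dots> = (2 - \<mu> k) * F x k"
      using xk fin eigen by (simp add: algebra_simps)
    finally show "(\<Sum>y\<in>verts S. g x y * complex_of_real (F y k)) =
        complex_of_real (2 - \<mu> k) * complex_of_real (F x k)"
      unfolding g_def of_real_mult[symmetric] of_real_sum[symmetric] by simp
  qed
  ultimately have "(\<Prod>k\<in>K. [:- complex_of_real (2 - \<mu> k), 1:]) * [:- 2, 1:] ^ q =
      [:- 2, 1:] ^ p * char_poly (2 \<cdot>\<^sub>m 1\<^sub>m q - transpose_mat C * C)"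
    using char_poly_scalar_minus_mult_commute[OF Cc transpose_carrier_mat[THEN iffD2, OF Cc], of 2] by simp
  also have "2 \<cdot>\<^sub>m 1\<^sub>m q - transpose_mat C * C = map_mat of_int (adj_matrix es L)"
    unfolding adj HH'[symmetric] by (rule eq_matI) (use Hc in \<open>auto simp: len\<close>)
  \<comment> \<open>Here \<open>p \<le> q\<close> makes the truncated difference exact, so that the
    power with exponent \<open>p\<close> can be cancelled from both sides.\<close>
  also have "[:- 2, 1 :: complex:] ^ q = [:- 2, 1:] ^ p * [:- 2, 1:] ^ (q - p)"
    using le by (simp add: p_def q_def power_add[symmetric])
  finally have "[:- 2, 1:] ^ p * char_poly (map_mat of_int (adj_matrix es L)) =
      [:- 2, 1:] ^ p * ((\<Prod>k\<in>K. [:- complex_of_real (2 - \<mu> k), 1:]) * [:- 2, 1:] ^ (q - p))"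
    by (simp only: mult.assoc mult.left_commute[of "\<Prod>k\<in>K. _ k"])
  then have cp: "char_poly (map_mat of_int (adj_matrix es L)) =
      (\<Prod>k\<in>K. [:- complex_of_real (2 - \<mu> k), 1:]) * [:- 2, 1:] ^ (q - p)"
    by simp
  have "proots (\<Prod>k\<in>K. [:- complex_of_real (2 - \<mu> k), 1:]) =
      image_mset (\<lambda>k. complex_of_real (2 - \<mu> k)) (mset_set K)"
    using K(1) by (subst proots_prod) (auto simp: sum_unfold_sum_mset)
  moreover have "proots ([:- 2, 1 :: complex:] ^ (q - p)) = replicate_mset (q - p) 2"
    by (simp add: proots_power)
  moreover have "proots ((\<Prod>k\<in>K. [:- complex_of_real (2 - \<mu> k), 1:]) * [:- 2, 1:] ^ (q - p)) =
      proots (\<Prod>k\<in>K. [:- complex_of_real (2 - \<mu> k), 1:]) + proots ([:- 2, 1:] ^ (q - p))"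
    using K(1) by (intro proots_mult) auto
  moreover have "sg_eigenvalues L = proots ((\<Prod>k\<in>K. [:- complex_of_real (2 - \<mu> k), 1:]) * [:- 2, 1:] ^ (q - p))"
    using sg_eigenvalues_listing[of es L] es vL cp by simp
  ultimately show ?thesis
    unfolding p_def[symmetric] q_def[symmetric] by (simp only:)
qed

subsection \<open>Signed paths\<close>

text \<open>A path has no cycle, so switching at vertices can make every edge negative, which turns
  all off-diagonal Laplacian entries of neighbours into 1. The signs \<open>t\<close> record this
  switching. The guard \<open>0 < i\<close> excludes the truncated predecessor of position
  0.\<close>

lemma signed_path_laplacian:
  assumes S: "signed_graph S" and p: "listing p (verts S)" "length p = n"
    and E: "edges S = {{p ! i, p ! Suc i} | i. Suc i < n}"
  shows "\<exists>t :: nat \<Rightarrow> int. (\<forall>i. t i * t i = 1) \<and>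
    (\<forall>i<n. \<forall>j<n. signed_laplacian S (p ! i) (p ! j) = t i * t j *
      ((if j = i then of_bool (0 < i) + of_bool (Suc i < n) else 0) +
       (if j = Suc i then 1 else 0) + (if 0 < i \<and> j = i - 1 then 1 else 0)))"
proof -
  have inj: "p ! i = p ! j \<longleftrightarrow> i = j" if "i < n" "j < n" for i j
    using p that unfolding listing_def by (simp add: nth_eq_iff_index_eq)
  \<comment> \<open>The default 1 past the last edge lets \<open>sg i * sg i = 1\<close> hold for
    all \<open>i\<close>.\<close>
  define sg where "sg = (\<lambda>i. if Suc i < n then esign S {p ! i, p ! Suc i} else 1)"
  have sg: "sg i * sg i = 1" for i
  proof (cases "Suc i < n")
    case True
    then have "{p ! i, p ! Suc i} \<in> edges S" unfolding E by blast
    then have "esign S {p ! i, p ! Suc i} = 1 \<or> esign S {p ! i, p ! Suc i} = -1"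
      using S unfolding signed_graph_def by blast
    then show ?thesis by (auto simp: sg_def)
  qed (simp add: sg_def)
  \<comment> \<open>Partial products of the negated edge signs: consecutive values then multiply to
    \<open>- sg i\<close>, the Laplacian entry of the edge between positions \<open>i\<close> and
    \<open>Suc i\<close>.\<close>
  define t where "t = (\<lambda>i. \<Prod>k<i. - sg k)"
  have tSuc: "t (Suc i) = - sg i * t i" for i by (simp add: t_def)
  have tt: "t i * t i = 1" for i
    by (simp add: t_def prod.distrib[symmetric] sg)
  have tS: "t i * t (Suc i) = - sg i" for i
    using tt[of i] by (simp add: tSuc)
  have deg: "card {e \<in> edges S. p ! i \<in> e} = of_bool (0 < i) + of_bool (Suc i < n)" if i: "i < n" for i
  proof -
    have "{e \<in> edges S. p ! i \<in> e} = (\<lambda>k. {p ! k, p ! Suc k}) ` {k. Suc k < n \<and> (k = i \<or> Suc k = i)}"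
      unfolding E using inj i by fastforce
    moreover have "inj_on (\<lambda>k. {p ! k, p ! Suc k}) {k. Suc k < n \<and> (k = i \<or> Suc k = i)}"
      using inj by (auto simp: inj_on_def doubleton_eq_iff)
    ultimately have "card {e \<in> edges S. p ! i \<in> e} = card {k. Suc k < n \<and> (k = i \<or> Suc k = i)}"
      by (simp add: card_image)
    also have "{k. Suc k < n \<and> (k = i \<or> Suc k = i)} =
        (if 0 < i then {i - 1} else {}) \<union> (if Suc i < n then {i} else {})"
      using i by auto
    also have "card \<dots> = of_bool (0 < i) + of_bool (Suc i < n)" by auto
    finally show ?thesis .
  qed
  have edge: "{p ! i, p ! j} \<in> edges S \<longleftrightarrow> j = Suc i \<or> i = Suc j" if ij: "i < n" "j < n" for i j
  proof
    assume "{p ! i, p ! j} \<in> edges S"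
    then obtain k where "Suc k < n" "{p ! i, p ! j} = {p ! k, p ! Suc k}" unfolding E by blast
    then show "j = Suc i \<or> i = Suc j" using ij inj by (auto simp: doubleton_eq_iff)
  next
    assume "j = Suc i \<or> i = Suc j"
    then show "{p ! i, p ! j} \<in> edges S"
    proof
      assume "j = Suc i" then show ?thesis unfolding E using ij by blast
    next
      assume "i = Suc j" then show ?thesis unfolding E using ij by (subst insert_commute) blast
    qed
  qed
  have "signed_laplacian S (p ! i) (p ! j) = t i * t j *
      ((if j = i then of_bool (0 < i) + of_bool (Suc i < n) else 0) +
       (if j = Suc i then 1 else 0) + (if 0 < i \<and> j = i - 1 then 1 else 0))"
    if ij: "i < n" "j < n" for i j
  proof -
    consider "i = j" | "j = Suc i" | "i = Suc j" | "i \<noteq> j" "j \<noteq> Suc i" "i \<noteq> Suc j" by blast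
    then show ?thesis
    proof cases
      case 1
      then show ?thesis using deg ij tt by (auto simp: signed_laplacian_def)
    next
      case 2
      then show ?thesis using edge[OF ij] inj[OF ij] ij tS[of i]
        by (auto simp: signed_laplacian_def sg_def)
    next
      case 3
      then show ?thesis using edge[OF ij] inj[OF ij] ij tS[of j]
        by (simp add: signed_laplacian_def sg_def insert_commute mult.commute)
    next
      case 4
      then show ?thesis using edge[OF ij] inj[OF ij] by (auto simp: signed_laplacian_def)
    qed
  qed
  then show ?thesis using tt by blast
qed

text \<open>
  The sine wave \<open>sin (\<theta> (i + 1/2))\<close> is antisymmetric about \<open>i = - 1/2\<close> and, for
  \<open>n \<theta> \<in> \<pi> \<int>\<close>, also about \<open>i = n - 1/2\<close>, so that it satisfies the boundary
  conditions of the path.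
\<close>
lemma path_sine_wave:
  fixes k n i :: nat
  assumes i: "i < n"
  defines "w \<equiv> \<lambda>i. sin (pi * real k * (2 * real i + 1) / (2 * real n))"
  shows "(of_bool (0 < i) + of_bool (Suc i < n)) * w i
      + (if Suc i < n then w (Suc i) else 0) + (if 0 < i then w (i - 1) else 0)
    = (2 + 2 * cos (pi * real k / real n)) * w i"
proof -
  define \<theta> where "\<theta> = pi * real k / real n"
  have n: "n > 0" using i by simp
  \<comment> \<open>The wave is extended to real positions, so that the fictitious neighbours at -1
    and \<open>n\<close> make sense.\<close>
  define W where "W = (\<lambda>x. sin (\<theta> * (x + 1 / 2)))"
  have w: "w j = W (real j)" for j
    using n by (simp add: w_def W_def \<theta>_def field_simps)
  have rec: "W (x + 1) + W (x - 1) = 2 * cos \<theta> * W x" for x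
  proof -
    have "\<theta> * (x + 1 + 1 / 2) = \<theta> * (x + 1 / 2) + \<theta>" "\<theta> * (x - 1 + 1 / 2) = \<theta> * (x + 1 / 2) - \<theta>"
      by (simp_all add: algebra_simps)
    then show ?thesis unfolding W_def by (simp only: sin_add sin_diff) simp
  qed
  have left: "W (- 1) = - W 0"
    by (simp add: W_def)
  \<comment> \<open>Since \<open>n\<close> times \<open>\<theta>\<close> is \<open>k\<close> times
    \<open>pi\<close>, where sine vanishes, the wave is odd about the point halfway between
    positions \<open>n - 1\<close> and \<open>n\<close>.\<close>
  have right: "W (real n) = - W (real n - 1)"
  proof -
    have "\<theta> * (real n + 1 / 2) = real k * pi + \<theta> / 2"
      "\<theta> * (real n - 1 + 1 / 2) = real k * pi - \<theta> / 2"
      using n by (simp_all add: \<theta>_def field_simps)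
    then show ?thesis unfolding W_def by (simp only: sin_add sin_diff) (simp add: sin_npi)
  qed
  \<comment> \<open>At the last vertex the fictitious neighbour has value
    \<open>- W (real i)\<close>; the added \<open>W (real i)\<close> cancels it and also fills the
    degree up to 2. The first vertex behaves likewise.\<close>
  have next_w: "(if Suc i < n then w (Suc i) else 0) = W (real i + 1) + (if Suc i < n then 0 else W (real i))"
  proof (cases "Suc i < n")
    case True
    then show ?thesis by (simp add: w add.commute)
  next
    case False
    then have "real i = real n - 1" using i by simp
    then show ?thesis using False right by simp
  qed
  have prev_w: "(if 0 < i then w (i - 1) else 0) = W (real i - 1) + (if 0 < i then 0 else W (real i))"
    using left by (cases i) (simp_all add: w)
  show ?thesis
    unfolding next_w prev_w using rec[of "real i"]
    by (cases i) (simp_all add: w \<theta>_def[symmetric] algebra_simps)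
qed

text \<open>All the angles lie between 0 and \<open>pi\<close>, where cosine is injective. This
  makes the eigenvalues of a path distinct.\<close>

lemma cos_pi_div_inj:
  fixes k l n :: nat
  assumes "k \<in> {1..n}" "l \<in> {1..n}" "cos (pi * real k / real n) = cos (pi * real l / real n)"
  shows "k = l"
proof -
  have n: "n > 0" using assms(1) by simp
  have ge: "0 \<le> pi * real j / real n" for j by simp
  have le: "pi * real j / real n \<le> pi" if "j \<in> {1..n}" for j
    using that n by (simp add: pos_divide_le_eq)
  have "pi * real k / real n = pi * real l / real n"
    by (rule cos_inj_pi[OF ge le[OF assms(1)] ge le[OF assms(2)] assms(3)])
  then show ?thesis using n by simp
qed

text \<open>Switched sine waves are eigenvectors; distinct eigenvalues of a symmetric matrix make
  them orthogonal, so no trigonometric sum is evaluated. Division by the norm, known only to be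
  positive, makes them orthonormal.\<close>

lemma signed_path_orthonormal_eigenbasis:
  fixes S :: "'a sgraph"
  assumes S: "is_signed_path n r S" and n: "n > 0"
  obtains F :: "'a \<Rightarrow> nat \<Rightarrow> real"
  where "\<forall>k\<in>{1..n}. \<forall>l\<in>{1..n}. (\<Sum>x\<in>verts S. F x k * F x l) = of_bool (k = l)"
    and "\<forall>x\<in>verts S. \<forall>k\<in>{1..n}.
      (\<Sum>y\<in>verts S. of_int (signed_laplacian S x y) * F y k) = (2 + 2 * cos (pi * real k / real n)) * F x k"
proof -
  have sg: "signed_graph S"
    using S unfolding is_signed_path_def by (elim conjE)
  obtain p where p: "listing p (verts S)" "length p = n"
    and E: "edges S = {{p ! i, p ! Suc i} | i. Suc i < n}"
    using S unfolding is_signed_path_def by (elim conjE exE) (rule that)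
  have fin: "finite (verts S)" using sg by (rule signed_graph_finite_verts)
  obtain t :: "nat \<Rightarrow> int" where t: "\<forall>i. t i * t i = 1"
    "\<forall>i<n. \<forall>j<n. signed_laplacian S (p ! i) (p ! j) = t i * t j *
      ((if j = i then of_bool (0 < i) + of_bool (Suc i < n) else 0) +
       (if j = Suc i then 1 else 0) + (if 0 < i \<and> j = i - 1 then 1 else 0))"
    using signed_path_laplacian[OF sg p E] by (elim exE conjE) (rule that)
  note tt = t(1)[rule_format] and lap = t(2)[rule_format]
  define w where "w = (\<lambda>k i. sin (pi * real k * (2 * real i + 1) / (2 * real n)))"
  define idx where "idx = inv_into {..<n} (nth p)"
  have bij: "bij_betw (nth p) {..<n} (verts S)"
    using bij_betw_nth[of p "{..<n}" "verts S"] p unfolding listing_def by auto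
  have idx: "idx (p ! i) = i" if "i < n" for i
    unfolding idx_def using bij that by (auto intro!: inv_into_f_f simp: bij_betw_def)
  have sumV: "(\<Sum>y\<in>verts S. h y) = (\<Sum>i<n. h (p ! i))" for h :: "'a \<Rightarrow> real"
    using sum_nth_listing[OF p(1), of h] p(2) by simp
  \<comment> \<open>The sine wave read along the path, multiplied by the switching signs to fit the
    given signature.\<close>
  define G where "G = (\<lambda>x k. of_int (t (idx x)) * w k (idx x))"
  define \<mu> where "\<mu> = (\<lambda>k. 2 + 2 * cos (pi * real k / real n))"
  define M where "M = (\<lambda>x y. real_of_int (signed_laplacian S x y))"
  have eig: "(\<Sum>y\<in>verts S. M x y * G y k) = \<mu> k * G x k" if x: "x \<in> verts S" for x k
  proof -
    obtain i where i: "i < n" "x = p ! i" using x bij by (auto simp: bij_betw_def)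
    \<comment> \<open>Each of the three terms is put in the form of a delta at one index, so that
      the sum over \<open>j\<close> collapses. For \<open>i = 0\<close> the index
      \<open>i - 1\<close> is 0 and the inner guard gives the value 0.\<close>
    have "M x (p ! j) * G (p ! j) k = of_int (t i) *
        ((if j = i then (of_bool (0 < i) + of_bool (Suc i < n)) * w k j else 0) +
         (if j = Suc i then w k j else 0) + (if j = i - 1 then (if 0 < i then w k j else 0) else 0))"
      if j: "j < n" for j
    proof -
      have "real_of_int (t j) * real_of_int (t j) = 1"
        using tt[of j] unfolding of_int_mult[symmetric] by simp
      then have "real_of_int (t i) * real_of_int (t j) * a * (real_of_int (t j) * b) =
          of_int (t i) * (a * b)" for a b :: real
        by (metis (no_types, lifting) mult.assoc mult.left_commute mult_1)
      then show ?thesis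
        unfolding M_def G_def i(2) lap[OF i(1) j] idx[OF j] of_int_mult
        by (auto simp: algebra_simps)
    qed
    then have "(\<Sum>y\<in>verts S. M x y * G y k) = (\<Sum>j<n. of_int (t i) *
        ((if j = i then (of_bool (0 < i) + of_bool (Suc i < n)) * w k j else 0) +
         (if j = Suc i then w k j else 0) + (if j = i - 1 then (if 0 < i then w k j else 0) else 0)))"
      unfolding sumV by simp
    also have "\<dots> = of_int (t i) * ((of_bool (0 < i) + of_bool (Suc i < n)) * w k i
        + (if Suc i < n then w k (Suc i) else 0) + (if 0 < i then w k (i - 1) else 0))"
      unfolding sum_distrib_left[symmetric] sum.distrib using i(1) by (simp add: sum.delta)
    also have "\<dots> = \<mu> k * G x k"
      unfolding w_def using path_sine_wave[OF i(1), of k]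
      by (simp add: G_def i(2) idx[OF i(1)] \<mu>_def w_def)
    finally show ?thesis .
  qed
  \<comment> \<open>Symmetry moves the Laplacian from one factor of the inner product to the other,
    so the product is multiplied equally by \<open>\<mu> k\<close> and by
    \<open>\<mu> l\<close>.\<close>
  have orth: "(\<Sum>x\<in>verts S. G x k * G x l) = 0" if kl: "k \<in> {1..n}" "l \<in> {1..n}" "k \<noteq> l" for k l
  proof -
    have "\<mu> k * (\<Sum>x\<in>verts S. G x k * G x l) = (\<Sum>x\<in>verts S. \<mu> k * G x k * G x l)"
      by (simp add: sum_distrib_left mult.assoc)
    also have "\<dots> = (\<Sum>x\<in>verts S. (\<Sum>y\<in>verts S. M x y * G y k) * G x l)"
      by (simp add: eig)
    also have "\<dots> = (\<Sum>x\<in>verts S. \<Sum>y\<in>verts S. M x y * G y k * G x l)"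
      by (simp add: sum_distrib_right)
    also have "\<dots> = (\<Sum>y\<in>verts S. \<Sum>x\<in>verts S. M x y * G y k * G x l)"
      by (rule sum.swap)
    also have "\<dots> = (\<Sum>y\<in>verts S. G y k * (\<Sum>x\<in>verts S. M y x * G x l))"
      by (simp add: sum_distrib_left M_def signed_laplacian_commute[of S _] ac_simps)
    also have "\<dots> = (\<Sum>y\<in>verts S. G y k * (\<mu> l * G y l))"
      by (simp add: eig)
    also have "\<dots> = \<mu> l * (\<Sum>x\<in>verts S. G x k * G x l)"
      by (simp add: sum_distrib_left mult.left_commute)
    finally have "\<mu> k = \<mu> l \<or> (\<Sum>x\<in>verts S. G x k * G x l) = 0" by auto
    then show ?thesis using cos_pi_div_inj kl by (auto simp: \<mu>_def)
  qed
  define N where "N k = (\<Sum>x\<in>verts S. G x k * G x k)" for k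
  have pos: "N k > 0" if k: "k \<in> {1..n}" for k
  proof -
    have "p ! 0 \<in> verts S" using bij n by (auto simp: bij_betw_def)
    \<comment> \<open>This is the angle of the wave at position 0; it lies strictly between 0 and
      \<open>pi\<close>, so the first entry is nonzero.\<close>
    have "pi * real k / (2 * real n) < pi"
    proof -
      have "pi * real k < pi * (2 * real n)" using k n by (intro mult_strict_left_mono) auto
      then show ?thesis using n by (simp add: field_simps)
    qed
    then have "w k 0 > 0"
      unfolding w_def using k n by (intro sin_gt_zero) auto
    moreover have "t 0 \<noteq> 0" using tt[of 0] by auto
    ultimately have "G (p ! 0) k \<noteq> 0"
      by (simp add: G_def idx[OF n])
    then have "G (p ! 0) k * G (p ! 0) k > 0"
      using not_real_square_gt_zero by blast
    then show ?thesis
      unfolding N_def using fin \<open>p ! 0 \<in> verts S\<close> by (intro sum_pos2[of _ "p ! 0"]) auto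
  qed
  show thesis
  proof (rule that[of "\<lambda>x k. G x k / sqrt (N k)"]; intro ballI)
    fix k l assume kl: "k \<in> {1..n}" "l \<in> {1..n}"
    have "(\<Sum>x\<in>verts S. G x k / sqrt (N k) * (G x l / sqrt (N l))) =
        (\<Sum>x\<in>verts S. G x k * G x l) / (sqrt (N k) * sqrt (N l))"
      by (simp add: sum_divide_distrib)
    also have "\<dots> = of_bool (k = l)"
      using orth[OF kl] pos[OF kl(1)] by (cases "k = l") (auto simp: N_def[symmetric])
    finally show "(\<Sum>x\<in>verts S. G x k / sqrt (N k) * (G x l / sqrt (N l))) = of_bool (k = l)" .
  next
    fix x k assume "x \<in> verts S" "k \<in> {1..n}"
    then show "(\<Sum>y\<in>verts S. of_int (signed_laplacian S x y) * (G y k / sqrt (N k))) =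
        (2 + 2 * cos (pi * real k / real n)) * (G x k / sqrt (N k))"
      using eig[of x k] by (simp add: M_def \<mu>_def sum_divide_distrib[symmetric])
  qed
qed

section \<open>Vertex and edge counts of signed paths\<close>

lemma card_verts_signed_path:
  assumes "is_signed_path n r S"
  shows "card (verts S) = n"
proof -
  obtain p where "listing p (verts S)" "length p = n"
    using assms unfolding is_signed_path_def by (elim conjE exE) (rule that)
  then show ?thesis using distinct_card unfolding listing_def by metis
qed

lemma card_edges_signed_path:
  assumes "is_signed_path n r S"
  shows "card (edges S) = n - 1"
proof -
  obtain p where p: "listing p (verts S)" "length p = n"
    and E: "edges S = {{p ! i, p ! Suc i} | i. Suc i < n}"
    using assms unfolding is_signed_path_def by (elim conjE exE) (rule that)
  have "inj_on (\<lambda>i. {p ! i, p ! Suc i}) {..<n - 1}"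
    using p by (auto simp: inj_on_def doubleton_eq_iff listing_def nth_eq_iff_index_eq)
  moreover have "edges S = (\<lambda>i. {p ! i, p ! Suc i}) ` {..<n - 1}"
    unfolding E by (auto simp: less_diff_conv)
  ultimately show ?thesis by (simp add: card_image)
qed

subsection \<open>Cartesian products\<close>

lemma edge_cart_prod_iff:
  "{(x, y), (x', y')} \<in> edges (cart_prod S T) \<longleftrightarrow>
    y = y' \<and> y \<in> verts T \<and> {x, x'} \<in> edges S \<or> x = x' \<and> x \<in> verts S \<and> {y, y'} \<in> edges T"
  (is "?l \<longleftrightarrow> ?r")
proof
  assume ?l
  then consider
    (1) u u' v where "{(x, y), (x', y')} = {(u, v), (u', v)}" "{u, u'} \<in> edges S" "v \<in> verts T"
  | (2) u v v' where "{(x, y), (x', y')} = {(u, v), (u, v')}" "u \<in> verts S" "{v, v'} \<in> edges T"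
    unfolding cart_prod_def by auto
  then show ?r by cases (auto simp: doubleton_eq_iff insert_commute)
next
  assume ?r
  then show ?l unfolding cart_prod_def by auto
qed

text \<open>Writing edges as set products parametrises both families by injective maps, which is
  what the counts of edges and degrees use.\<close>

lemma edges_cart_prod:
  assumes "signed_graph S" "signed_graph T"
  shows "edges (cart_prod S T) = (\<lambda>(e, v). e \<times> {v}) ` (edges S \<times> verts T) \<union>
    (\<lambda>(u, f). {u} \<times> f) ` (verts S \<times> edges T)"
proof -
  have "{{(u, v), (u', v)} | u u' v. {u, u'} \<in> edges S \<and> v \<in> verts T} =
      (\<lambda>(e, v). e \<times> {v}) ` (edges S \<times> verts T)" (is "?l = ?r")
  proof (intro subset_antisym subsetI)
    fix g assume "g \<in> ?l"
    then obtain u u' v where "g = {(u, v), (u', v)}" "{u, u'} \<in> edges S" "v \<in> verts T" by blast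
    then show "g \<in> ?r" by (intro image_eqI[of _ _ "({u, u'}, v)"]) auto
  next
    fix g assume "g \<in> ?r"
    then obtain e v where ev: "e \<in> edges S" "v \<in> verts T" "g = e \<times> {v}" by auto
    obtain u u' where "e = {u, u'}" using assms(1) ev(1) by (rule signed_graph_edgeE)
    then have "g = {(u, v), (u', v)}" "{u, u'} \<in> edges S" using ev by auto
    then show "g \<in> ?l" using ev(2) by blast
  qed
  moreover have "{{(u, v), (u, v')} | u v v'. u \<in> verts S \<and> {v, v'} \<in> edges T} =
      (\<lambda>(u, f). {u} \<times> f) ` (verts S \<times> edges T)" (is "?l = ?r")
  proof (intro subset_antisym subsetI)
    fix g assume "g \<in> ?l"
    then obtain u v v' where "g = {(u, v), (u, v')}" "{v, v'} \<in> edges T" "u \<in> verts S" by blast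
    then show "g \<in> ?r" by (intro image_eqI[of _ _ "(u, {v, v'})"]) auto
  next
    fix g assume "g \<in> ?r"
    then obtain u f where uf: "u \<in> verts S" "f \<in> edges T" "g = {u} \<times> f" by auto
    obtain v v' where "f = {v, v'}" using assms(2) uf(2) by (rule signed_graph_edgeE)
    then have "g = {(u, v), (u, v')}" "{v, v'} \<in> edges T" using uf by auto
    then show "g \<in> ?l" using uf(1) by blast
  qed
  ultimately show ?thesis unfolding cart_prod_def by simp
qed

text \<open>The left side has two different first coordinates, the right side at most one. Hence the
  two families of edges are disjoint.\<close>

lemma edge_times_singleton_neq:
  assumes "signed_graph S" "e \<in> edges S"
  shows "e \<times> {v} \<noteq> {u} \<times> f"
proof
  assume eq: "e \<times> {v} = {u} \<times> f"
  obtain a b where "a \<noteq> b" "e = {a, b}" using assms by (rule signed_graph_edgeE)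
  then have "(a, v) \<in> {u} \<times> f" "(b, v) \<in> {u} \<times> f" unfolding eq[symmetric] by auto
  then show False using \<open>a \<noteq> b\<close> by simp
qed

text \<open>Excludes the degenerate case in which set products coincide because a factor is
  empty.\<close>

lemma edge_not_empty:
  assumes "signed_graph S"
  shows "{} \<notin> edges S"
proof
  assume "{} \<in> edges S"
  with assms show False by (rule signed_graph_edgeE) simp
qed

lemma card_edges_cart_prod:
  assumes S: "signed_graph S" and T: "signed_graph T"
  shows "card (edges (cart_prod S T)) =
    card (edges S) * card (verts T) + card (verts S) * card (edges T)"
proof -
  have fin: "finite (edges S)" "finite (edges T)" "finite (verts S)" "finite (verts T)"
    using S T by (simp_all add: finite_edges signed_graph_finite_verts)
  have "inj_on (\<lambda>(e, v). e \<times> {v}) (edges S \<times> verts T)"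
    using edge_not_empty[OF S] by (auto simp: inj_on_def times_eq_iff)
  moreover have "inj_on (\<lambda>(u, f). {u} \<times> f) (verts S \<times> edges T)"
    using edge_not_empty[OF T] by (auto simp: inj_on_def times_eq_iff)
  moreover have "(\<lambda>(e, v). e \<times> {v}) ` (edges S \<times> verts T) \<inter>
      (\<lambda>(u, f). {u} \<times> f) ` (verts S \<times> edges T) = {}"
    by (auto simp: edge_times_singleton_neq[OF S])
  ultimately show ?thesis
    unfolding edges_cart_prod[OF S T] using fin
    by (simp add: card_Un_disjoint card_image card_cartesian_product)
qed

lemma degree_cart_prod:
  assumes S: "signed_graph S" and T: "signed_graph T" and xy: "x \<in> verts S" "y \<in> verts T"
  shows "card {g \<in> edges (cart_prod S T). (x, y) \<in> g} =
    card {e \<in> edges S. x \<in> e} + card {f \<in> edges T. y \<in> f}"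
proof -
  have fin: "finite (edges S)" "finite (edges T)" using S T by (simp_all add: finite_edges)
  have "{g \<in> edges (cart_prod S T). (x, y) \<in> g} =
      (\<lambda>e. e \<times> {y}) ` {e \<in> edges S. x \<in> e} \<union> (\<lambda>f. {x} \<times> f) ` {f \<in> edges T. y \<in> f}"
    unfolding edges_cart_prod[OF S T] using xy by auto
  moreover have "inj_on (\<lambda>e. e \<times> {y}) {e \<in> edges S. x \<in> e}" "inj_on (\<lambda>f. {x} \<times> f) {f \<in> edges T. y \<in> f}"
    by (auto simp: inj_on_def times_eq_iff)
  moreover have "(\<lambda>e. e \<times> {y}) ` {e \<in> edges S. x \<in> e} \<inter> (\<lambda>f. {x} \<times> f) ` {f \<in> edges T. y \<in> f} = {}"
    by (auto simp: edge_times_singleton_neq[OF S])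
  ultimately show ?thesis using fin by (simp add: card_Un_disjoint card_image)
qed

text \<open>The Kronecker sum: degrees add on the diagonal, a change of one coordinate gives the
  entry of that factor, and a change of both gives no edge.\<close>

lemma signed_laplacian_cart_prod:
  assumes S: "signed_graph S" and T: "signed_graph T" and xy: "x \<in> verts S" "y \<in> verts T"
  shows "signed_laplacian (cart_prod S T) (x, y) (x', y') =
    signed_laplacian S x x' * of_bool (y = y') + of_bool (x = x') * signed_laplacian T y y'"
proof -
  \<comment> \<open>The sign of a product edge comes from \<open>T\<close> unless its first
    projection is an edge of \<open>S\<close>; for \<open>x = x'\<close> that projection is this
    singleton.\<close>
  have no_loop: "{x} \<notin> edges S" using signed_graph_edgeD[OF S, of x x] by auto
  have sign: "esign (cart_prod S T) {(x, y), (x', y')} =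
      (if {x, x'} \<in> edges S then esign S {x, x'} else esign T {y, y'})" for x x' y y'
    by (simp add: cart_prod_def)
  consider "x = x'" "y = y'" | "x \<noteq> x'" "y = y'" | "x = x'" "y \<noteq> y'" | "x \<noteq> x'" "y \<noteq> y'" by blast
  then show ?thesis
  proof cases
    case 1
    then show ?thesis using degree_cart_prod[OF S T xy] by (simp add: signed_laplacian_def)
  qed (use no_loop xy in \<open>simp_all add: signed_laplacian_def edge_cart_prod_iff sign\<close>)
qed

section \<open>Spectrum and energy of the line graph of the signed grid\<close>

lemma cos_pi_div_gt_neg_one:
  fixes i m :: nat
  assumes "i \<in> {1..m}" "i \<noteq> m"
  shows "cos (pi * real i / real m) > -1"
proof -
  \<comment> \<open>Cosine decreases strictly to -1 at \<open>pi\<close>, and only the index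
    \<open>m\<close> reaches that angle.\<close>
  have "pi * real i / real m < pi" using assms by (simp add: pos_divide_less_eq)
  then show ?thesis
    using cos_monotone_0_pi[of "pi * real i / real m" pi] by simp
qed

theorem corollary4p9:
  fixes P :: "'a sgraph" and Q :: "'b sgraph" and L :: "('a \<times> 'b) set sgraph"
    and m n r1 r2 :: nat and lam :: "nat \<Rightarrow> nat \<Rightarrow> real"
  assumes "m \<ge> 2" and "n \<ge> 2" and "r1 \<le> m - 1" and "r2 \<le> n - 1"
    and "is_signed_path m r1 P" and "is_signed_path n r2 Q"
    and "is_line_graph (cart_prod P Q) L"
    and lam: "\<And>i j. lam i j = -2 - 2 * (cos (pi * real i / real m) + cos (pi * real j / real n))"
  shows "sg_eigenvalues L =
           image_mset (\<lambda>(i, j). complex_of_real (lam i j)) (mset_set ({1..m} \<times> {1..n}))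
           + replicate_mset ((m - 1) * (n - 1) - 1) 2 \<and>
    (\<forall>i\<in>{1..m}. \<forall>j\<in>{1..n}. (i, j) \<noteq> (m, n) \<longrightarrow> lam i j < 2) \<and>
    lam m n = 2 \<and>
    energy L =
           2 * (\<Sum>i=1..m. \<Sum>j=1..n. \<bar>1 + cos (pi * real i / real m) + cos (pi * real j / real n)\<bar>)
           + 2 * (real m - 1) * (real n - 1) - 2"
proof -
  note mn = \<open>m \<ge> 2\<close> \<open>n \<ge> 2\<close>
  then have mn_pos: "m > 0" "n > 0" by simp_all
  note paths = \<open>is_signed_path m r1 P\<close> \<open>is_signed_path n r2 Q\<close>
  have sg: "signed_graph P" "signed_graph Q"
    using paths by (simp_all only: is_signed_path_def)
  have fin: "finite (verts P)" "finite (verts Q)" using sg by (simp_all add: signed_graph_finite_verts)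
  have cardV: "card (verts P) = m" "card (verts Q) = n"
    using card_verts_signed_path paths by blast+
  have V: "verts (cart_prod P Q) = verts P \<times> verts Q" by (simp add: cart_prod_def)
  have cardE: "card (edges (cart_prod P Q)) = (m - 1) * n + m * (n - 1)"
    by (simp add: card_edges_cart_prod[OF sg] card_edges_signed_path[OF paths(1)]
        card_edges_signed_path[OF paths(2)] cardV)
  define k where "k = (m - 1) * (n - 1) - 1"
  \<comment> \<open>Subtracting 2 from both sizes exposes two successors, so the truncated
    subtractions in \<open>k\<close> become exact; in particular \<open>(m - 1) * (n - 1)\<close> is
    at least 1.\<close>
  obtain a b where ab: "m = Suc (Suc a)" "n = Suc (Suc b)"
    by (rule that[of "m - 2" "n - 2"]) (use mn in simp_all)
  \<comment> \<open>The left side counts the edges of the grid and \<open>m * n\<close> its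
    vertices, so \<open>k\<close> is the multiplicity of the additional eigenvalue 2.\<close>
  have k: "(m - 1) * n + m * (n - 1) = m * n + k"
    by (simp add: k_def ab)
  have cardE': "card (edges (cart_prod P Q)) = m * n + k"
    unfolding cardE k ..
  obtain F1 where F1: "\<forall>k\<in>{1..m}. \<forall>l\<in>{1..m}. (\<Sum>x\<in>verts P. F1 x k * F1 x l) = of_bool (k = l)"
    "\<forall>x\<in>verts P. \<forall>k\<in>{1..m}. (\<Sum>y\<in>verts P. of_int (signed_laplacian P x y) * F1 y k) =
      (2 + 2 * cos (pi * real k / real m)) * F1 x k"
    using paths(1) mn_pos(1) by (rule signed_path_orthonormal_eigenbasis)
  obtain F2 where F2: "\<forall>k\<in>{1..n}. \<forall>l\<in>{1..n}. (\<Sum>x\<in>verts Q. F2 x k * F2 x l) = of_bool (k = l)"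
    "\<forall>x\<in>verts Q. \<forall>k\<in>{1..n}. (\<Sum>y\<in>verts Q. of_int (signed_laplacian Q x y) * F2 y k) =
      (2 + 2 * cos (pi * real k / real n)) * F2 x k"
    using paths(2) mn_pos(2) by (rule signed_path_orthonormal_eigenbasis)
  define F where "F = (\<lambda>(x, y) (i, j). F1 x i * F2 y j)"
  \<comment> \<open>The Laplacian eigenvalues of the two paths add up to \<open>2 - lam i j\<close>,
    which takes the role of \<open>\<mu>\<close>.\<close>
  have eigenvalues: "sg_eigenvalues L =
      image_mset (\<lambda>k. complex_of_real (2 - (2 - (case k of (i, j) \<Rightarrow> lam i j)))) (mset_set ({1..m} \<times> {1..n}))
      + replicate_mset (card (edges (cart_prod P Q)) - card (verts (cart_prod P Q))) 2"
  proof (rule sg_eigenvalues_line_graph[OF signed_graph_cart_prod[OF sg] assms(7), where F = F])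
    show "card ({1..m} \<times> {1..n}) = card (verts (cart_prod P Q))"
      by (simp add: V card_cartesian_product cardV)
    show "card (verts (cart_prod P Q)) \<le> card (edges (cart_prod P Q))"
      by (simp add: V card_cartesian_product cardV cardE')
  next
    fix u v assume uv: "u \<in> {1..m} \<times> {1..n}" "v \<in> {1..m} \<times> {1..n}"
    obtain i j i' j' where ij: "u = (i, j)" "v = (i', j')" by (metis surj_pair)
    have "(\<Sum>x\<in>verts P \<times> verts Q. F x u * F x v) =
        (\<Sum>x\<in>verts P. F1 x i * F1 x i') * (\<Sum>y\<in>verts Q. F2 y j * F2 y j')"
      unfolding sum_product sum.cartesian_product by (intro sum.cong) (auto simp: F_def ij)
    also have "\<dots> = of_bool (u = v)" using F1(1) F2(1) uv by (auto simp: ij)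
    finally show "(\<Sum>x\<in>verts (cart_prod P Q). F x u * F x v) = of_bool (u = v)" by (simp add: V)
  next
    fix z u assume "z \<in> verts (cart_prod P Q)" "u \<in> {1..m} \<times> {1..n}"
    then obtain x y i j where z: "z = (x, y)" "x \<in> verts P" "y \<in> verts Q"
      and u: "u = (i, j)" "i \<in> {1..m}" "j \<in> {1..n}" by (auto simp: V)
    \<comment> \<open>The two terms of the Kronecker sum are written as conditionals, each of which
      collapses the sum over one coordinate.\<close>
    have "(\<Sum>w\<in>verts (cart_prod P Q). of_int (signed_laplacian (cart_prod P Q) z w) * F w u) =
        (\<Sum>x'\<in>verts P. \<Sum>y'\<in>verts Q.
          (if y = y' then of_int (signed_laplacian P x x') * F1 x' i * F2 y' j else 0)
          + (if x = x' then F1 x' i * (of_int (signed_laplacian Q y y') * F2 y' j) else 0))"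
      unfolding V sum.cartesian_product
      by (intro sum.cong) (auto simp: F_def z u signed_laplacian_cart_prod[OF sg z(2,3)] algebra_simps)
    also have "\<dots> = (\<Sum>x'\<in>verts P. of_int (signed_laplacian P x x') * F1 x' i) * F2 y j
        + F1 x i * (\<Sum>y'\<in>verts Q. of_int (signed_laplacian Q y y') * F2 y' j)"
    proof -
      have "(\<Sum>x'\<in>verts P. \<Sum>y'\<in>verts Q.
          (if x = x' then F1 x' i * (of_int (signed_laplacian Q y y') * F2 y' j) else 0)) =
          (\<Sum>x'\<in>verts P. if x = x' then F1 x' i * (\<Sum>y'\<in>verts Q. of_int (signed_laplacian Q y y') * F2 y' j) else 0)"
        by (intro sum.cong) (auto simp: sum_distrib_left)
      then show ?thesis
        using z fin by (simp add: sum.distrib sum_distrib_right)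
    qed
    also have "\<dots> = (2 - lam i j) * (F1 x i * F2 y j)"
      using bspec[OF bspec[OF F1(2) z(2)] u(2)] bspec[OF bspec[OF F2(2) z(3)] u(3)] by (simp add: lam algebra_simps)
    finally show "(\<Sum>w\<in>verts (cart_prod P Q). of_int (signed_laplacian (cart_prod P Q) z w) * F w u) =
        (2 - (case u of (i, j) \<Rightarrow> lam i j)) * F z u"
      by (simp add: F_def z u)
  qed simp
  then have spec: "sg_eigenvalues L =
      image_mset (\<lambda>(i, j). complex_of_real (lam i j)) (mset_set ({1..m} \<times> {1..n}))
      + replicate_mset k 2"
    by (simp add: V cardE' card_cartesian_product cardV case_prod_unfold)
  have "lam i j < 2" if ij: "i \<in> {1..m}" "j \<in> {1..n}" "(i, j) \<noteq> (m, n)" for i j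
  proof -
    \<comment> \<open>The bound 2 is reached only if both cosines equal -1; away from
      \<open>(m, n)\<close> at least one of them is larger.\<close>
    have less: "- 2 - 2 * (a + b) < 2" if "- 1 \<le> a" "- 1 \<le> b" "- 1 < a \<or> - 1 < b" for a b :: real
      using that by auto
    have "i \<noteq> m \<or> j \<noteq> n" using ij(3) by simp
    then show ?thesis
      unfolding lam
      using cos_pi_div_gt_neg_one[OF ij(1)] cos_pi_div_gt_neg_one[OF ij(2)]
      by (intro less cos_ge_minus_one) blast
  qed
  moreover have "lam m n = 2" using mn by (simp add: lam)
  moreover have "energy L =
      2 * (\<Sum>i=1..m. \<Sum>j=1..n. \<bar>1 + cos (pi * real i / real m) + cos (pi * real j / real n)\<bar>)
      + 2 * (real m - 1) * (real n - 1) - 2"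
  proof -
    \<comment> \<open>The eigenvalues are real, so the modulus is the absolute value; each of the
      \<open>k\<close> extra eigenvalues contributes 2.\<close>
    have "energy L = (\<Sum>(i, j)\<in>{1..m} \<times> {1..n}. \<bar>lam i j\<bar>) + 2 * real k"
      unfolding energy_def spec
      by (simp add: sum_unfold_sum_mset multiset.map_comp comp_def case_prod_unfold)
    also have "(\<Sum>(i, j)\<in>{1..m} \<times> {1..n}. \<bar>lam i j\<bar>) =
        2 * (\<Sum>i=1..m. \<Sum>j=1..n. \<bar>1 + cos (pi * real i / real m) + cos (pi * real j / real n)\<bar>)"
      unfolding sum.cartesian_product[symmetric] sum_distrib_left
      by (intro sum.cong refl) (simp add: lam abs_if)
    also have "2 * real k = 2 * (real m - 1) * (real n - 1) - 2"
      by (simp add: k_def ab algebra_simps)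
    finally show ?thesis by simp
  qed
  ultimately show ?thesis using spec unfolding k_def by blast
qed

end
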